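(* Let $G$ be a finite simple graph. The leaf-removal procedure described below, applied to $G$, ends with the empty graph if and only if $G$ is a K\"{o}nig-Egerv\'{a}ry graph that has a unique perfect matching. In that case the set $M$ it outputs is the unique perfect matching of $G$.
   Context: For a graph $G$, $\alpha(G)$ is the maximum size of an independent set and $\mu(G)$ is the maximum size of a matching. $G$ is a K\"{o}nig-Egerv\'{a}ry graph if $\alpha(G)+\mu(G)=|V(G)|$. A perfect matching is a matching saturating every vertex. A leaf is a vertex of degree exactly $1$. The leaf-removal procedure (a variant of the Karp-Sipser algorithm) works as follows. Start with $M=\emptyset$ and the current graph equal to $G$. As long as the current graph has a leaf $w$, choose one, add to $M$ the edge joining $w$ to its only neighbor $u$, and delete both $w$ and $u$, together with all edges incident to them, from the current graph. The procedure stops when the current graph has no leaf, and it outputs $M$ together with the remaining graph. The procedure "ends with the empty graph" if the remaining graph has no vertices. *)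

theory Defs
  imports Main "HOL-Library.Ramsey"
begin

definition finite_simple_graph :: "'a set \<Rightarrow> 'a set set \<Rightarrow> bool" where
  "finite_simple_graph V E \<longleftrightarrow> finite V \<and> E \<subseteq> nsets V 2"

definition degree :: "'a set set \<Rightarrow> 'a \<Rightarrow> nat" where
  "degree E v = card {e \<in> E. v \<in> e}"

definition leaf :: "'a set \<Rightarrow> 'a set set \<Rightarrow> 'a \<Rightarrow> bool" where
  "leaf V E w \<longleftrightarrow> w \<in> V \<and> degree E w = 1"

definition matching :: "'a set set \<Rightarrow> 'a set set \<Rightarrow> bool" where
  "matching E M \<longleftrightarrow> M \<subseteq> E \<and> pairwise disjnt M"

definition perfect_matching :: "'a set \<Rightarrow> 'a set set \<Rightarrow> 'a set set \<Rightarrow> bool" where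
  "perfect_matching V E M \<longleftrightarrow> matching E M \<and> (\<forall>v\<in>V. \<exists>e\<in>M. v \<in> e)"

definition independence_number :: "'a set \<Rightarrow> 'a set set \<Rightarrow> nat" where
  "independence_number V E = Max {card S | S. S \<subseteq> V \<and> indep S E}"

definition matching_number :: "'a set set \<Rightarrow> nat" where
  "matching_number E = Max {card M | M. matching E M}"

definition Koenig_Egervary :: "'a set \<Rightarrow> 'a set set \<Rightarrow> bool" where
  "Koenig_Egervary V E \<longleftrightarrow> independence_number V E + matching_number E = card V"

text \<open>\<open>leaf_removal_reach V E M V' E'\<close>: started on \<open>(V, E)\<close>, some sequence of choices of
  leaves leads after finitely many steps to the set \<open>M\<close> and the current graph \<open>(V', E')\<close>.\<close>

inductive leaf_removal_reach ::
  "'a set \<Rightarrow> 'a set set \<Rightarrow> 'a set set \<Rightarrow> 'a set \<Rightarrow> 'a set set \<Rightarrow> bool"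
  for V E where
  start: "leaf_removal_reach V E {} V E"
| step: "leaf_removal_reach V E M V' E' \<Longrightarrow> leaf V' E' w \<Longrightarrow> {w, u} \<in> E' \<Longrightarrow>
    leaf_removal_reach V E (insert {w, u} M) (V' - {w, u}) {e \<in> E'. w \<notin> e \<and> u \<notin> e}"

text \<open>The output depends on the choices of leaves, so it is a relation.\<close>

definition leaf_removal_output ::
  "'a set \<Rightarrow> 'a set set \<Rightarrow> 'a set set \<Rightarrow> 'a set \<Rightarrow> 'a set set \<Rightarrow> bool" where
  "leaf_removal_output V E M V' E' \<longleftrightarrow>
     leaf_removal_reach V E M V' E' \<and> (\<nexists>w. leaf V' E' w)"

lemma leaf_obtains_edge:
  assumes "E \<subseteq> nsets V 2" "leaf V E w"
  obtains u where "{w, u} \<in> E"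
proof -
  from assms(2) have "card {e \<in> E. w \<in> e} = 1" by (simp add: leaf_def degree_def)
  then obtain e where "{e \<in> E. w \<in> e} = {e}" by (auto simp: card_1_singleton_iff)
  then have e: "e \<in> E" "w \<in> e" by auto
  with assms(1) have "card e = 2" by (auto simp: nsets_def)
  with e that show ?thesis by (auto simp: card_2_iff insert_commute)
qed

lemma leaf_removal_output_exists:
  assumes "finite_simple_graph V E"
  shows "\<exists>M V' E'. leaf_removal_output V E M V' E'"
proof -
  have "\<exists>M V' E'. leaf_removal_output V E M V' E'"
    if "leaf_removal_reach V E M0 V0 E0" "finite V0" "E0 \<subseteq> nsets V0 2" for M0 V0 E0
    using that
  proof (induction "card V0" arbitrary: M0 V0 E0 rule: less_induct)
    case less
    show ?case
    proof (cases "\<exists>w. leaf V0 E0 w")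
      case True
      then obtain w where w: "leaf V0 E0 w" by blast
      then obtain u where u: "{w, u} \<in> E0" using less.prems(3) leaf_obtains_edge by metis
      have "w \<in> V0" using w by (simp add: leaf_def)
      then have "card (V0 - {w, u}) < card V0"
        using less.prems(2) by (intro psubset_card_mono) auto
      moreover have "{e \<in> E0. w \<notin> e \<and> u \<notin> e} \<subseteq> nsets (V0 - {w, u}) 2"
        using less.prems(3) by (auto simp: nsets_def)
      ultimately show ?thesis
        using less.hyps[OF _ leaf_removal_reach.step[OF less.prems(1) w u]] less.prems(2) by simp
    next
      case False
      then show ?thesis using less.prems(1) unfolding leaf_removal_output_def by blast
    qed
  qed
  then show ?thesis
    using assms leaf_removal_reach.start unfolding finite_simple_graph_def by metis
qed

end

theory Submission
  imports Defs
begin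

text \<open>
  Let \<open>N\<close> be a perfect matching. Then \<open>G\<close> is a Koenig-Egervary graph iff some independent
  set meets every edge of \<open>N\<close>. Removing a leaf and its neighbour preserves
  both this property and uniqueness of the perfect matching, in either direction, because the leaf
  edge lies in every perfect matching and the leaf can be added to any independent set avoiding its
  neighbour. It remains to see that a nonempty graph with both properties has a leaf. If it had
  none, every vertex of the independent set \<open>S\<close> would have a neighbour along an edge outside \<open>N\<close>;
  going there and back to \<open>S\<close> along \<open>N\<close> is a self-map of the finite set \<open>S\<close>, which
  permutes some nonempty subset, and exchanging edges along its cycles gives a second perfect
  matching.
\<close>

text \<open>When \<open>N\<close> is a perfect matching, these are the independent sets with exactly
  one vertex on each edge of \<open>N\<close>, that is, those of the largest conceivable size
  \<open>card N\<close>.\<close>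

definition independent_transversal :: "'a set \<Rightarrow> 'a set set \<Rightarrow> 'a set set \<Rightarrow> 'a set \<Rightarrow> bool" where
  "independent_transversal V E N S \<longleftrightarrow> S \<subseteq> V \<and> indep S E \<and> (\<forall>e\<in>N. e \<inter> S \<noteq> {})"

section \<open>Counting in matchings and independent sets\<close>

lemma edge_card_subset:
  assumes "finite_simple_graph V E" "e \<in> E"
  shows "card e = 2" "e \<subseteq> V" "finite e"
  using assms by (auto simp: finite_simple_graph_def nsets_def)

lemma finite_edges:
  assumes "finite_simple_graph V E"
  shows "finite E"
proof -
  have "E \<subseteq> Pow V" using edge_card_subset(2)[OF assms] by auto
  moreover have "finite V" using assms by (simp add: finite_simple_graph_def)
  ultimately show ?thesis by (meson finite_Pow_iff finite_subset)
qed

lemma indep_edge_unique: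
  assumes "finite_simple_graph V E" "indep S E" "e \<in> E" "x \<in> S" "y \<in> S" "x \<in> e" "y \<in> e"
  shows "x = y"
proof (rule ccontr)
  assume "x \<noteq> y"
  have "card e = 2" using edge_card_subset(1)[OF assms(1,3)] .
  then have "e = {x, y}" using assms(6,7) \<open>x \<noteq> y\<close> by (auto simp: card_2_iff)
  then show False using assms(2-5) \<open>x \<noteq> y\<close> by (auto simp: indep_def)
qed

lemma matching_edge_unique:
  assumes "matching E M" "e \<in> M" "f \<in> M" "x \<in> e" "x \<in> f"
  shows "e = f"
  using assms unfolding matching_def pairwise_def disjnt_def by blast

lemma card_Union_matching:
  assumes "finite_simple_graph V E" "matching E M"
  shows "card (\<Union>M) = 2 * card M"
proof -
  have "\<And>e. e \<in> M \<Longrightarrow> card e = 2 \<and> finite e"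
    using assms(2) edge_card_subset(1,3)[OF assms(1)] unfolding matching_def by blast
  then show ?thesis
    using card_Union_disjoint[of M] assms(2) unfolding matching_def by simp
qed

lemma card_perfect_matching:
  assumes "finite_simple_graph V E" "perfect_matching V E N"
  shows "card V = 2 * card N"
proof -
  have "\<Union>N = V"
    using assms(2) edge_card_subset(2)[OF assms(1)] unfolding perfect_matching_def matching_def by blast
  then show ?thesis
    using card_Union_matching assms unfolding perfect_matching_def by metis
qed

text \<open>A matching covers two vertices per edge, hence has at most half of \<open>card V\<close>
  edges, and \<open>N\<close> attains this.\<close>

lemma matching_number_perfect:
  assumes "finite_simple_graph V E" "perfect_matching V E N"
  shows "matching_number E = card N"
  unfolding matching_number_def
proof (rule Max_eqI)
  have "{card M | M. matching E M} \<subseteq> card ` Pow E" by (auto simp: matching_def)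
  then show "finite {card M | M. matching E M}"
    using finite_edges[OF assms(1)] by (simp add: finite_subset)
  show "card N \<in> {card M | M. matching E M}" using assms(2) by (auto simp: perfect_matching_def)
next
  fix k assume "k \<in> {card M | M. matching E M}"
  then obtain M where M: "k = card M" "matching E M" by blast
  have "\<Union>M \<subseteq> V" using M(2) edge_card_subset(2)[OF assms(1)] by (auto simp: matching_def)
  then have "card (\<Union>M) \<le> card V"
    using assms(1) by (simp add: card_mono finite_simple_graph_def)
  then show "k \<le> card N"
    using card_Union_matching[OF assms(1) M(2)] card_perfect_matching[OF assms] M(1) by simp
qed

text \<open>Sending each vertex of \<open>S\<close> to the edge of \<open>N\<close> covering it is
  injective, since no edge has two vertices in \<open>S\<close>. Equality of cardinalities therefore
  means that the map is onto \<open>N\<close>.\<close>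

lemma indep_perfect_matching_bound:
  assumes "finite_simple_graph V E" "perfect_matching V E N" "S \<subseteq> V" "indep S E"
  shows "card S \<le> card N" and "card S = card N \<longleftrightarrow> (\<forall>e\<in>N. e \<inter> S \<noteq> {})"
proof -
  have NE: "N \<subseteq> E" and mat: "matching E N" using assms(2) by (auto simp: perfect_matching_def matching_def)
  have fN: "finite N" using NE finite_edges[OF assms(1)] finite_subset by blast
  have "\<forall>v\<in>S. \<exists>e. e \<in> N \<and> v \<in> e" using assms(2,3) by (auto simp: perfect_matching_def)
  then obtain p where p: "\<And>v. v \<in> S \<Longrightarrow> p v \<in> N \<and> v \<in> p v" by metis
  have inj: "inj_on p S"
  proof (rule inj_onI)
    fix x y assume "x \<in> S" "y \<in> S" "p x = p y"
    then show "x = y"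
      using p[of x] p[of y] indep_edge_unique[OF assms(1,4), of "p x" x y] NE by auto
  qed
  have sub: "p ` S \<subseteq> N" using p by auto
  show "card S \<le> card N" using card_inj_on_le[OF inj sub fN] .
  have "card S = card N \<longleftrightarrow> p ` S = N"
    using card_image[OF inj] card_subset_eq[OF fN sub] by auto
  also have "\<dots> \<longleftrightarrow> (\<forall>e\<in>N. e \<inter> S \<noteq> {})"
  proof
    assume "p ` S = N"
    then show "\<forall>e\<in>N. e \<inter> S \<noteq> {}" using p by blast
  next
    assume hit: "\<forall>e\<in>N. e \<inter> S \<noteq> {}"
    have "e \<in> p ` S" if e: "e \<in> N" for e
    proof -
      obtain x where x: "x \<in> e" "x \<in> S" using hit e by blast
      then have "p x = e" using p[of x] matching_edge_unique[OF mat _ e, of "p x" x] by simp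
      then show ?thesis using x by blast
    qed
    then show "p ` S = N" using sub by blast
  qed
  finally show "card S = card N \<longleftrightarrow> (\<forall>e\<in>N. e \<inter> S \<noteq> {})" .
qed

text \<open>Since \<open>card V\<close> is \<open>2 * card N\<close> and the matching number is
  \<open>card N\<close>, the property says that the independence number is \<open>card N\<close>, an
  upper bound attained exactly by the transversals.\<close>

lemma Koenig_Egervary_iff_independent_transversal:
  assumes "finite_simple_graph V E" "perfect_matching V E N"
  shows "Koenig_Egervary V E \<longleftrightarrow> (\<exists>S. independent_transversal V E N S)"
proof -
  let ?A = "{card S | S. S \<subseteq> V \<and> indep S E}"
  have "?A \<subseteq> card ` Pow V" by auto
  moreover have "finite V" using assms(1) by (simp add: finite_simple_graph_def)
  ultimately have fin: "finite ?A" by (simp add: finite_subset)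
  have ne: "?A \<noteq> {}"
    using null_indep by blast
  have le: "\<forall>k\<in>?A. k \<le> card N" using indep_perfect_matching_bound(1)[OF assms] by blast
  have "Koenig_Egervary V E \<longleftrightarrow> Max ?A = card N"
    using card_perfect_matching[OF assms] matching_number_perfect[OF assms]
    unfolding Koenig_Egervary_def independence_number_def by simp
  also have "\<dots> \<longleftrightarrow> card N \<in> ?A"
  proof
    assume "Max ?A = card N"
    then show "card N \<in> ?A" using Max_in[OF fin ne] by (rule subst)
  next
    assume "card N \<in> ?A"
    then show "Max ?A = card N" using le by (intro Max_eqI[OF fin]) (rule bspec)
  qed
  also have "\<dots> \<longleftrightarrow> (\<exists>S. S \<subseteq> V \<and> indep S E \<and> card S = card N)" by (auto intro: sym)
  also have "\<dots> \<longleftrightarrow> (\<exists>S. independent_transversal V E N S)"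
    using indep_perfect_matching_bound(2)[OF assms] unfolding independent_transversal_def by blast
  finally show ?thesis .
qed

section \<open>A leaf from uniqueness of the perfect matching\<close>

lemma exists_invariant_bij_subset:
  assumes "finite S" "S \<noteq> {}" "f ` S \<subseteq> S"
  obtains C where "C \<subseteq> S" "C \<noteq> {}" "f ` C = C" "inj_on f C"
proof -
  let ?P = "\<lambda>C. C \<subseteq> S \<and> C \<noteq> {} \<and> f ` C \<subseteq> C"
  have "?P S" using assms by blast
  \<comment> \<open>A smallest nonempty invariant set works: its image is again nonempty and
    invariant, so it cannot be smaller.\<close>
  then obtain C where C: "?P C" and min: "\<And>D. ?P D \<Longrightarrow> card C \<le> card D"
    using ex_has_least_nat[of ?P S card] by blast
  have fin: "finite C" using C assms(1) finite_subset by blast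
  have "?P (f ` C)" using C by blast
  then have "card C \<le> card (f ` C)" by (rule min)
  then have eq: "f ` C = C" using C by (intro card_seteq[OF fin]) auto
  then have "inj_on f C" using eq_card_imp_inj_on[OF fin] by metis
  then show thesis using that C eq by blast
qed

text \<open>The edges of \<open>N\<close> meeting \<open>C\<close> are the \<open>{f s, g s}\<close>
  with \<open>s\<close> in \<open>C\<close>. Because \<open>f\<close> permutes \<open>C\<close>, the
  edges \<open>{s, g s}\<close> cover the same vertices and can replace them.\<close>

lemma exchange_perfect_matching:
  assumes pm: "perfect_matching V E N" and bip: "g ` C \<inter> C = {}"
    and edges: "\<And>s. s \<in> C \<Longrightarrow> {s, g s} \<in> E" "\<And>s. s \<in> C \<Longrightarrow> {f s, g s} \<in> N"
    and perm: "f ` C = C" "inj_on f C"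
    and once: "\<And>e x y. e \<in> N \<Longrightarrow> x \<in> C \<Longrightarrow> y \<in> C \<Longrightarrow> x \<in> e \<Longrightarrow> y \<in> e \<Longrightarrow> x = y"
  shows "perfect_matching V E ({e \<in> N. e \<inter> C = {}} \<union> (\<lambda>s. {s, g s}) ` C)"
    (is "perfect_matching V E (?A \<union> ?B)")
proof -
  have mat: "matching E N" using pm by (simp add: perfect_matching_def)
  note uniq = matching_edge_unique[OF mat]
  have sub: "?A \<union> ?B \<subseteq> E" using mat edges(1) by (auto simp: matching_def)
  have fC: "f s \<in> C" if "s \<in> C" for s using perm that by blast
  have ginj: "s = t" if "s \<in> C" "t \<in> C" "g s = g t" for s t
  proof -
    \<comment> \<open>Both edges lie in \<open>N\<close> and share \<open>g s\<close>. The common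
      edge has only one vertex in \<open>C\<close>, so \<open>f s\<close> and \<open>f t\<close>
      agree.\<close>
    have "{f s, g s} = {f t, g t}"
      using uniq[OF edges(2)[OF that(1)] edges(2)[OF that(2)], of "g s"] that(3) by simp
    then have "f s = f t"
      using once[OF edges(2)[OF that(1)] fC[OF that(1)] fC[OF that(2)]] by blast
    then show ?thesis using perm(2) that by (simp add: inj_on_def)
  qed
  have AB: "disjnt e {s, g s}" if "e \<in> ?A" "s \<in> C" for e s
  proof -
    have "g s \<notin> e"
    proof
      assume "g s \<in> e"
      then have "e = {f s, g s}" using uniq[OF _ edges(2)[OF that(2)]] that(1) by blast
      then show False using that fC[of s] by blast
    qed
    then show ?thesis using that by (auto simp: disjnt_def)
  qed
  have BB: "disjnt {s, g s} {t, g t}" if "s \<in> C" "t \<in> C" "s \<noteq> t" for s t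
    using that ginj[of s t] bip by (auto simp: disjnt_def)
  have AA: "disjnt e e'" if "e \<in> ?A" "e' \<in> ?A" "e \<noteq> e'" for e e'
    using that mat by (auto simp: matching_def pairwise_def)
  have "disjnt e e'" if "e \<in> ?A \<union> ?B" "e' \<in> ?A \<union> ?B" "e \<noteq> e'" for e e'
    using that(1)
  proof
    assume e: "e \<in> ?A"
    from that(2) show ?thesis
      using AA[OF e _ that(3)] AB[OF e] by blast
  next
    assume "e \<in> ?B"
    then obtain s where s: "s \<in> C" "e = {s, g s}" by blast
    from that(2) show ?thesis
    proof
      assume "e' \<in> ?A"
      then show ?thesis using AB s disjnt_sym by blast
    next
      assume "e' \<in> ?B"
      then obtain t where t: "t \<in> C" "e' = {t, g t}" by blast
      then have "s \<noteq> t" using s that(3) by blast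
      then show ?thesis using BB s t by simp
    qed
  qed
  then have "matching E (?A \<union> ?B)" using sub by (auto simp: matching_def pairwise_def)
  moreover have "\<exists>e\<in>?A \<union> ?B. v \<in> e" if "v \<in> V" for v
  proof -
    obtain e where e: "e \<in> N" "v \<in> e" using pm \<open>v \<in> V\<close> by (auto simp: perfect_matching_def)
    show ?thesis
    proof (cases "e \<inter> C = {}")
      case True
      then show ?thesis using e by blast
    next
      case False
      then obtain c where "c \<in> e" "c \<in> C" by blast
      then obtain s where s: "s \<in> C" "f s \<in> e" using equalityD2[OF perm(1)] by fast
      then have "e = {f s, g s}" using uniq[OF e(1) edges(2)[OF s(1)]] by blast
      then have "v = f s \<or> v = g s" using e(2) by blast
      then show ?thesis using s fC[OF s(1)] by blast
    qed
  qed
  ultimately show ?thesis by (simp add: perfect_matching_def)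
qed

lemma leaf_if_unique_perfect_matching:
  assumes G: "finite_simple_graph V E" and "V \<noteq> {}" and pm: "perfect_matching V E N"
    and unique: "\<And>N'. perfect_matching V E N' \<Longrightarrow> N' = N"
    and S: "independent_transversal V E N S"
  shows "\<exists>w. leaf V E w"
proof (rule ccontr)
  assume noleaf: "\<nexists>w. leaf V E w"
  have SV: "S \<subseteq> V" and ind: "indep S E" and hit: "\<forall>e\<in>N. e \<inter> S \<noteq> {}"
    using S by (auto simp: independent_transversal_def)
  have mat: "matching E N" and NE: "N \<subseteq> E" using pm by (auto simp: perfect_matching_def matching_def)
  have finS: "finite S" using G SV finite_subset by (auto simp: finite_simple_graph_def)
  have neS: "S \<noteq> {}" using \<open>V \<noteq> {}\<close> pm hit by (fastforce simp: perfect_matching_def)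
  have "\<exists>t r. {s, t} \<in> E \<and> {s, t} \<notin> N \<and> t \<notin> S \<and> r \<in> S \<and> {r, t} \<in> N" if s: "s \<in> S" for s
  proof -
    obtain e where e: "e \<in> N" "s \<in> e" using s pm SV by (auto simp: perfect_matching_def)
    \<comment> \<open>The edge \<open>e\<close> of \<open>N\<close> cannot be the only edge at
      \<open>s\<close>, as \<open>s\<close> would then be a leaf.\<close>
    have "{e \<in> E. s \<in> e} \<noteq> {e}"
      using noleaf s SV unfolding leaf_def degree_def by (metis card_1_singleton_iff One_nat_def subsetD)
    then obtain e' where e': "e' \<in> E" "s \<in> e'" "e' \<noteq> e" using e NE by blast
    have e'N: "e' \<notin> N" using matching_edge_unique[OF mat] e e' by blast
    obtain t where t: "e' = {s, t}" "s \<noteq> t"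
      using edge_card_subset(1)[OF G e'(1)] e'(2) by (auto simp: card_2_iff)
    have tS: "t \<notin> S" using indep_edge_unique[OF G ind e'(1) s] t by blast
    have "t \<in> V" using edge_card_subset(2)[OF G e'(1)] t by simp
    then obtain d where d: "d \<in> N" "t \<in> d" using pm by (auto simp: perfect_matching_def)
    then obtain r where r: "r \<in> d" "r \<in> S" using hit by blast
    have "r \<noteq> t" using r tS by blast
    moreover have "card d = 2" using edge_card_subset(1)[OF G] d NE by blast
    ultimately have "d = {r, t}" using r d by (auto simp: card_2_iff)
    then show ?thesis using e' e'N t tS r d by metis
  qed
  \<comment> \<open>\<open>g s\<close> is the other end of a second edge at \<open>s\<close>, and
    \<open>f s\<close> is the vertex of \<open>S\<close> on the edge of \<open>N\<close> covering
    \<open>g s\<close>. Thus \<open>f\<close> is the self-map of \<open>S\<close> whose cycles are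
    exchanged.\<close>
  then obtain g f where gf: "\<And>s. s \<in> S \<Longrightarrow>
      {s, g s} \<in> E \<and> {s, g s} \<notin> N \<and> g s \<notin> S \<and> f s \<in> S \<and> {f s, g s} \<in> N"
    by metis
  have "f ` S \<subseteq> S" using gf by blast
  then obtain C where C: "C \<subseteq> S" "C \<noteq> {}" "f ` C = C" "inj_on f C"
    using exists_invariant_bij_subset[OF finS neS] by metis
  have "perfect_matching V E ({e \<in> N. e \<inter> C = {}} \<union> (\<lambda>s. {s, g s}) ` C)"
  proof (rule exchange_perfect_matching[OF pm _ _ _ C(3,4)])
    show "g ` C \<inter> C = {}" using C(1) gf by blast
    show "{s, g s} \<in> E" "{f s, g s} \<in> N" if "s \<in> C" for s using that C(1) gf by blast+
    show "x = y" if "e \<in> N" "x \<in> C" "y \<in> C" "x \<in> e" "y \<in> e" for e x y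
      using indep_edge_unique[OF G ind, of e x y] that C(1) NE by blast
  qed
  \<comment> \<open>Uniqueness forces the exchanged edges into \<open>N\<close>, but they were
    chosen outside it and \<open>C\<close> is nonempty.\<close>
  then have "(\<lambda>s. {s, g s}) ` C \<subseteq> N" using unique by blast
  then show False using C gf by blast
qed

section \<open>Removing one leaf and its neighbour\<close>

locale leaf_edge =
  fixes V :: "'a set" and E :: "'a set set" and w u :: 'a
  assumes graph: "finite_simple_graph V E" and leaf: "leaf V E w" and edge: "{w, u} \<in> E"
begin

abbreviation "V1 \<equiv> V - {w, u}"
abbreviation "E1 \<equiv> {e \<in> E. w \<notin> e \<and> u \<notin> e}"

lemma graph_removed: "finite_simple_graph V1 E1"
  using graph by (auto simp: finite_simple_graph_def nsets_def)

lemma leaf_edge_unique: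
  assumes "e \<in> E" "w \<in> e"
  shows "e = {w, u}"
proof -
  obtain d where d: "{e \<in> E. w \<in> e} = {d}"
    using leaf by (auto simp: leaf_def degree_def card_1_singleton_iff)
  have "e \<in> {e \<in> E. w \<in> e}" "{w, u} \<in> {e \<in> E. w \<in> e}" using assms edge by auto
  then show ?thesis unfolding d by simp
qed

text \<open>The leaf can only be covered by its single edge \<open>{w, u}\<close>, and every other
  edge of a perfect matching avoids both ends.\<close>

lemma perfect_matching_iff:
  "perfect_matching V E N \<longleftrightarrow> (\<exists>N1. perfect_matching V1 E1 N1 \<and> N = insert {w, u} N1)"
proof
  assume pm: "perfect_matching V E N"
  then have mat: "matching E N" by (simp add: perfect_matching_def)
  have "w \<in> V" using leaf by (simp add: leaf_def)
  then obtain e where "e \<in> N" "w \<in> e" using pm by (auto simp: perfect_matching_def)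
  then have wu: "{w, u} \<in> N" using leaf_edge_unique mat by (metis matching_def subsetD)
  have "w \<notin> e \<and> u \<notin> e" if "e \<in> N" "e \<noteq> {w, u}" for e
    using matching_edge_unique[OF mat that(1) wu] that(2) by blast
  then have "perfect_matching V1 E1 (N - {{w, u}})"
    using pm by (fastforce simp: perfect_matching_def matching_def pairwise_def)
  then show "\<exists>N1. perfect_matching V1 E1 N1 \<and> N = insert {w, u} N1"
    using wu by blast
next
  assume "\<exists>N1. perfect_matching V1 E1 N1 \<and> N = insert {w, u} N1"
  then obtain N1 where pm: "perfect_matching V1 E1 N1" and N: "N = insert {w, u} N1" by blast
  have "\<forall>e\<in>N1. disjnt e {w, u}" using pm by (auto simp: perfect_matching_def matching_def disjnt_def)
  then have "pairwise disjnt N"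
    using pm disjnt_sym unfolding N perfect_matching_def matching_def pairwise_insert by blast
  then show "perfect_matching V E N"
    using pm edge unfolding N perfect_matching_def matching_def by blast
qed

lemma independent_transversal_iff:
  assumes "N1 \<subseteq> E1"
  shows "(\<exists>S. independent_transversal V E (insert {w, u} N1) S) \<longleftrightarrow>
    (\<exists>S. independent_transversal V1 E1 N1 S)"
proof
  assume "\<exists>S. independent_transversal V E (insert {w, u} N1) S"
  then obtain S where S: "independent_transversal V E (insert {w, u} N1) S" by blast
  have "independent_transversal V1 E1 N1 (S - {w, u})"
    unfolding independent_transversal_def
  proof (intro conjI ballI)
    show "S - {w, u} \<subseteq> V1" using S by (auto simp: independent_transversal_def)
    show "indep (S - {w, u}) E1" using S by (simp add: independent_transversal_def indep_def)
    fix e assume e: "e \<in> N1"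
    then have "e \<inter> S \<noteq> {}" using S by (simp add: independent_transversal_def)
    moreover have "w \<notin> e" "u \<notin> e" using e assms by auto
    ultimately show "e \<inter> (S - {w, u}) \<noteq> {}" by blast
  qed
  then show "\<exists>S. independent_transversal V1 E1 N1 S" by blast
next
  assume "\<exists>S. independent_transversal V1 E1 N1 S"
  then obtain S where S: "independent_transversal V1 E1 N1 S" by blast
  \<comment> \<open>The leaf \<open>w\<close> can join \<open>S\<close>: its only neighbour
    \<open>u\<close> lies outside \<open>V1\<close>. It then meets the new edge
    \<open>{w, u}\<close>.\<close>
  have "{w, x} \<notin> E" if "x \<in> S" for x
    using leaf_edge_unique[of "{w, x}"] S that by (auto simp: independent_transversal_def doubleton_eq_iff)
  moreover have "{x, y} \<notin> E" if "x \<in> S" "y \<in> S" "x \<noteq> y" for x y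
  proof -
    have "x \<notin> {w, u}" "y \<notin> {w, u}" using S that by (auto simp: independent_transversal_def)
    moreover have "{x, y} \<notin> E1" using S that by (simp add: independent_transversal_def indep_def)
    ultimately show ?thesis by auto
  qed
  ultimately have "indep (insert w S) E" by (auto simp: indep_def insert_commute)
  moreover have "w \<in> V" using leaf by (simp add: leaf_def)
  ultimately have "independent_transversal V E (insert {w, u} N1) (insert w S)"
    using S by (auto simp: independent_transversal_def)
  then show "\<exists>S. independent_transversal V E (insert {w, u} N1) S" by blast
qed

lemma Koenig_Egervary_iff:
  assumes "perfect_matching V1 E1 N1"
  shows "Koenig_Egervary V E \<longleftrightarrow> Koenig_Egervary V1 E1"
proof -
  have "perfect_matching V E (insert {w, u} N1)" using assms perfect_matching_iff by blast
  moreover have "N1 \<subseteq> E1" using assms unfolding perfect_matching_def matching_def by blast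
  ultimately show ?thesis
    using Koenig_Egervary_iff_independent_transversal[OF graph]
      Koenig_Egervary_iff_independent_transversal[OF graph_removed assms]
      independent_transversal_iff by simp
qed

end

section \<open>Whole runs of the procedure\<close>

lemma leaf_removal_reach_invariant:
  assumes "leaf_removal_reach V E M V' E'" "finite_simple_graph V E"
  shows "finite_simple_graph V' E'"
    and "E' \<subseteq> E - M"
    and "perfect_matching V E N \<longleftrightarrow> (\<exists>N'. perfect_matching V' E' N' \<and> N = M \<union> N')"
    and "perfect_matching V' E' N' \<Longrightarrow> Koenig_Egervary V E \<longleftrightarrow> Koenig_Egervary V' E'"
proof -
  \<comment> \<open>The inclusion in \<open>E - M\<close> keeps \<open>M\<close> disjoint from
    matchings of the current graph, so that \<open>N'\<close> can be recovered from
    \<open>M \<union> N'\<close>.\<close>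
  have "finite_simple_graph V' E' \<and> E' \<subseteq> E - M \<and>
    (\<forall>N. perfect_matching V E N \<longleftrightarrow> (\<exists>N'. perfect_matching V' E' N' \<and> N = M \<union> N')) \<and>
    (\<forall>N'. perfect_matching V' E' N' \<longrightarrow> Koenig_Egervary V E = Koenig_Egervary V' E')"
    using assms(1)
  proof induction
    case start
    then show ?case using assms(2) by simp
  next
    case (step M V' E' w u)
    then interpret leaf_edge V' E' w u by unfold_locales auto
    have "perfect_matching V E N \<longleftrightarrow>
        (\<exists>N1. perfect_matching V1 E1 N1 \<and> N = insert {w, u} M \<union> N1)" for N
    proof -
      have "perfect_matching V E N \<longleftrightarrow> (\<exists>N'. perfect_matching V' E' N' \<and> N = M \<union> N')"
        using step.IH by blast
      also have "\<dots> \<longleftrightarrow> (\<exists>N1. perfect_matching V1 E1 N1 \<and> N = M \<union> insert {w, u} N1)"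
        unfolding perfect_matching_iff by blast
      finally show ?thesis by simp
    qed
    moreover have "Koenig_Egervary V E = Koenig_Egervary V1 E1" if "perfect_matching V1 E1 N1" for N1
    proof -
      have "perfect_matching V' E' (insert {w, u} N1)" using that perfect_matching_iff by auto
      then have "Koenig_Egervary V E = Koenig_Egervary V' E'" using step.IH by blast
      then show ?thesis using Koenig_Egervary_iff[OF that] by simp
    qed
    ultimately show ?case using graph_removed step.IH by blast
  qed
  then show "finite_simple_graph V' E'" "E' \<subseteq> E - M"
    "perfect_matching V E N \<longleftrightarrow> (\<exists>N'. perfect_matching V' E' N' \<and> N = M \<union> N')"
    "perfect_matching V' E' N' \<Longrightarrow> Koenig_Egervary V E \<longleftrightarrow> Koenig_Egervary V' E'"
    by blast+
qed

theorem theorem3: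
  fixes V :: "'a set" and E :: "'a set set"
    and M :: "'a set set" and V' :: "'a set" and E' :: "'a set set"
  assumes "finite_simple_graph V E"
    and "leaf_removal_output V E M V' E'"
  shows "(V' = {} \<longleftrightarrow> Koenig_Egervary V E \<and> (\<exists>!N. perfect_matching V E N)) \<and>
    (V' = {} \<longrightarrow> perfect_matching V E M \<and> (\<forall>N. perfect_matching V E N \<longrightarrow> N = M))"
proof -
  have reach: "leaf_removal_reach V E M V' E'" and noleaf: "\<nexists>w. leaf V' E' w"
    using assms(2) by (auto simp: leaf_removal_output_def)
  note inv = leaf_removal_reach_invariant[OF reach assms(1)]
  have empty: "Koenig_Egervary V E \<and> (\<forall>N. perfect_matching V E N \<longleftrightarrow> N = M)" if "V' = {}"
  proof -
    have "E' = {}" using edge_card_subset[OF inv(1)] that by fastforce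
    \<comment> \<open>The empty graph has \<open>{}\<close> as its only perfect matching, so the
      invariant leaves \<open>M\<close> as the only one of the original graph.\<close>
    then have pm: "perfect_matching V' E' N' \<longleftrightarrow> N' = {}" for N'
      using that by (auto simp: perfect_matching_def matching_def)
    have "independent_transversal V' E' {} {}"
      by (simp add: independent_transversal_def indep_def)
    then have "Koenig_Egervary V' E'"
      using Koenig_Egervary_iff_independent_transversal[OF inv(1)] pm by blast
    then show ?thesis using inv(3,4) pm by simp
  qed
  moreover have "V' = {}" if KE: "Koenig_Egervary V E" and ex1: "\<exists>!N. perfect_matching V E N"
  proof (rule ccontr)
    assume ne: "V' \<noteq> {}"
    obtain N' where pm: "perfect_matching V' E' N'" using ex1 unfolding inv(3) by (elim ex1E exE conjE)
    have unique: "N'' = N'" if "perfect_matching V' E' N''" for N''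
    proof -
      have "perfect_matching V E (M \<union> N'')" "perfect_matching V E (M \<union> N')"
        using inv(3) pm that by auto
      then have "M \<union> N'' = M \<union> N'" using ex1 by auto
      \<comment> \<open>Disjointness allows \<open>M\<close> to be cancelled, which carries
        uniqueness over to the remaining graph.\<close>
      moreover have "N' \<inter> M = {}" "N'' \<inter> M = {}"
        using inv(2) pm that unfolding perfect_matching_def matching_def by blast+
      ultimately show ?thesis by blast
    qed
    obtain S where "independent_transversal V' E' N' S"
      using KE inv(4)[OF pm] Koenig_Egervary_iff_independent_transversal[OF inv(1) pm] by blast
    then show False
      using leaf_if_unique_perfect_matching[OF inv(1) ne pm unique] noleaf by blast
  qed
  ultimately show ?thesis by blast
qed

end
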